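(* Let $m,k$ be integers such that $k$ divides $m$ and $\gcd(2^m-1,2^k+1)=1$, let $e=2^m-2^k-2$ and $d$ such that $de\equiv1\pmod{2^m-1}$. For $\gamma\in\mathbb{F}_{2^k}$ let $\mathcal{A}(\gamma)=\bigcup_{s\in\mathbb{F}_{2^m}:{\rm Tr}^m_k(s)=\gamma}\{(x,sx^{2^k+1}):x\in\mathbb{F}_{2^m}^*\}$, $U=\{(0,y):y\in\mathbb{F}_{2^m}\}$, $\mathcal{B}(\gamma)=\bigcup_{s\in\mathbb{F}_{2^m}:{\rm Tr}^m_k(s)=\gamma}\{(x^{-d}s,x):x\in\mathbb{F}_{2^m}^*\}$, $V=\{(x,0):x\in\mathbb{F}_{2^m}\}$. I. Every Boolean function on $\mathbb{F}_{2^m}\times\mathbb{F}_{2^m}$ whose support is the union of $2^{k-1}$ of the sets $\mathcal{A}(\gamma)$ is bent; likewise every Boolean function whose support is the union of $U$ and $2^{k-1}$ of the sets $\mathcal{A}(\gamma)$ is bent. II. Every Boolean function whose support is the union of $2^{k-1}$ of the sets $\mathcal{B}(\gamma)$ is bent; likewise every Boolean function whose support is the union of $V$ and $2^{k-1}$ of the sets $\mathcal{B}(\gamma)$ is bent. Moreover, the dual of every bent function in class I belongs to class II, and the dual of every bent function in class II belongs to class I.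
   Context: ${\rm Tr}^m_k$ is the relative trace $\mathbb{F}_{2^m}\to\mathbb{F}_{2^k}$, ${\rm Tr}_m$ the absolute trace; powers of nonzero elements have exponents modulo $2^m-1$. A Boolean function $h$ on $\mathbb{F}_{2^m}\times\mathbb{F}_{2^m}$ is bent if $\mathcal{W}_h(u,v)=\sum_{x,y}(-1)^{h(x,y)\oplus{\rm Tr}_m(ux+vy)}$ has absolute value $2^m$ for all $u,v\in\mathbb{F}_{2^m}$; its dual $h^*$ is the Boolean function defined by $\mathcal{W}_h(u,v)=2^m(-1)^{h^*(u,v)}$. The support of a Boolean function is the set where it takes value $1$. *)

theory Defs
  imports "HOL-Number_Theory.Number_Theory" "HOL-Library.Cardinality"
begin

text \<open>
  Throughout, \<open>'a\<close> is a finite field with \<open>2 ^ m\<close> elements. For \<open>k dvd m\<close> its subfield with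
  \<open>2 ^ k\<close> elements is the fixed set of the \<open>k\<close>-th power of the Frobenius map.
\<close>

definition subfield_pow2 :: "nat \<Rightarrow> 'a::finite_field set" where
  "subfield_pow2 k = {x. x ^ (2 ^ k) = x}"

definition rel_trace :: "nat \<Rightarrow> nat \<Rightarrow> 'a::finite_field \<Rightarrow> 'a" where
  "rel_trace m k x = (\<Sum>i<m div k. x ^ (2 ^ (k * i)))"

definition abs_trace :: "nat \<Rightarrow> 'a::finite_field \<Rightarrow> 'a" where
  "abs_trace m x = rel_trace m 1 x"

text \<open>
  The absolute trace has values in \<open>{0, 1}\<close>, so its exclusive or with a truth value is taken
  by comparing with \<open>abs_trace m z = 1\<close>; on type \<open>bool\<close>, \<open>\<noteq>\<close> is exclusive or.
\<close>

definition walsh :: "nat \<Rightarrow> ('a::finite_field \<times> 'a \<Rightarrow> bool) \<Rightarrow> 'a \<times> 'a \<Rightarrow> int" where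
  "walsh m h = (\<lambda>(u, v). \<Sum>x\<in>UNIV. \<Sum>y\<in>UNIV.
     (-1) ^ of_bool (h (x, y) \<noteq> (abs_trace m (u * x + v * y) = 1)))"

definition bent :: "nat \<Rightarrow> ('a::finite_field \<times> 'a \<Rightarrow> bool) \<Rightarrow> bool" where
  "bent m h \<longleftrightarrow> (\<forall>u v. \<bar>walsh m h (u, v)\<bar> = 2 ^ m)"

definition bent_dual :: "nat \<Rightarrow> ('a::finite_field \<times> 'a \<Rightarrow> bool) \<Rightarrow> 'a \<times> 'a \<Rightarrow> bool" where
  "bent_dual m h = (THE g. \<forall>u v. walsh m h (u, v) = 2 ^ m * (-1) ^ of_bool (g (u, v)))"

definition bool_support :: "('a \<times> 'a \<Rightarrow> bool) \<Rightarrow> ('a \<times> 'a) set" where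
  "bool_support h = {p. h p}"

definition set_A :: "nat \<Rightarrow> nat \<Rightarrow> 'a::finite_field \<Rightarrow> ('a \<times> 'a) set" where
  "set_A m k \<gamma> = (\<Union>s\<in>{s. rel_trace m k s = \<gamma>}. {(x, s * x ^ (2 ^ k + 1)) | x. x \<noteq> 0})"

definition set_U :: "('a::finite_field \<times> 'a) set" where
  "set_U = {(0, y) | y. True}"

definition set_B :: "nat \<Rightarrow> nat \<Rightarrow> int \<Rightarrow> 'a::finite_field \<Rightarrow> ('a \<times> 'a) set" where
  "set_B m k d \<gamma> = (\<Union>s\<in>{s. rel_trace m k s = \<gamma>}. {(x powi (- d) * s, x) | x. x \<noteq> 0})"

definition set_V :: "('a::finite_field \<times> 'a) set" where
  "set_V = {(x, 0) | x. True}"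

definition class_I :: "nat \<Rightarrow> nat \<Rightarrow> ('a::finite_field \<times> 'a \<Rightarrow> bool) set" where
  "class_I m k = {h. \<exists>\<Gamma> \<subseteq> subfield_pow2 k. card \<Gamma> = 2 ^ (k - 1) \<and>
     (bool_support h = (\<Union>\<gamma>\<in>\<Gamma>. set_A m k \<gamma>) \<or>
      bool_support h = set_U \<union> (\<Union>\<gamma>\<in>\<Gamma>. set_A m k \<gamma>))}"

definition class_II :: "nat \<Rightarrow> nat \<Rightarrow> int \<Rightarrow> ('a::finite_field \<times> 'a \<Rightarrow> bool) set" where
  "class_II m k d = {h. \<exists>\<Gamma> \<subseteq> subfield_pow2 k. card \<Gamma> = 2 ^ (k - 1) \<and>
     (bool_support h = (\<Union>\<gamma>\<in>\<Gamma>. set_B m k d \<gamma>) \<or>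
      bool_support h = set_V \<union> (\<Union>\<gamma>\<in>\<Gamma>. set_B m k d \<gamma>))}"

lemma bent_dual_unique:
  fixes h :: "'a::finite_field \<times> 'a \<Rightarrow> bool"
  assumes "\<And>u v. walsh m h (u, v) = 2 ^ m * (-1) ^ of_bool (g (u, v))"
  shows "bent_dual m h = g"
  unfolding bent_dual_def
proof (rule the_equality)
  show "\<forall>u v. walsh m h (u, v) = 2 ^ m * (-1) ^ of_bool (g (u, v))"
    using assms by blast
next
  fix g'
  assume g': "\<forall>u v. walsh m h (u, v) = 2 ^ m * (-1) ^ of_bool (g' (u, v))"
  have "g' (u, v) = g (u, v)" for u v
  proof -
    have "(2 ^ m :: int) * (-1) ^ of_bool (g' (u, v)) = 2 ^ m * (-1) ^ of_bool (g (u, v))"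
      using g' assms by metis
    then show ?thesis
      by (cases "g' (u, v)"; cases "g (u, v)") auto
  qed
  then show "g' = g"
    by auto
qed

lemma walsh_eq_bent_dual:
  fixes h :: "'a::finite_field \<times> 'a \<Rightarrow> bool"
  assumes "bent m h"
  shows "walsh m h (u, v) = 2 ^ m * (-1) ^ of_bool (bent_dual m h (u, v))"
proof -
  define g where "g p \<longleftrightarrow> walsh m h p < 0" for p
  have g: "walsh m h (u, v) = 2 ^ m * (-1) ^ of_bool (g (u, v))" for u v
    using assms[unfolded bent_def, rule_format, of u v] by (auto simp: g_def)
  then show ?thesis
    using bent_dual_unique[of m h g] by metis
qed

lemma abs_trace_0_or_1:
  fixes z :: "'a::finite_field"
  assumes card: "CARD('a) = 2 ^ m"
  shows "abs_trace m z = 0 \<or> abs_trace m z = 1"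
proof -
  have "prime CHAR('a)"
    by (rule prime_CHAR_semidom) (simp add: CHAR_pos)
  moreover have "CHAR('a) dvd 2 ^ m"
    using CHAR_dvd_CARD[where ?'a = 'a] card by simp
  ultimately have char: "CHAR('a) = 2"
    by (meson prime_dvd_power primes_dvd_imp_eq two_is_prime_nat)
  have tr: "abs_trace m z = (\<Sum>i<m. z ^ (2 ^ i))"
    by (simp add: abs_trace_def rel_trace_def)
  have "abs_trace m z ^ 2 = (\<Sum>i<m. (z ^ (2 ^ i)) ^ 2)"
    unfolding tr by (rule freshmans_dream_sum) (simp_all add: char)
  also have "\<dots> = (\<Sum>i<m. z ^ (2 ^ Suc i))"
    by (simp only: power_Suc2 power_mult)
  also have "\<dots> = (\<Sum>i<Suc m. z ^ (2 ^ i)) - z"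
    by (subst sum.lessThan_Suc_shift) simp
  also have "\<dots> = abs_trace m z"
    using finite_field_power_card_eq_same[of z] card by (simp add: tr)
  finally have "abs_trace m z * (abs_trace m z - 1) = 0"
    by (simp only: power2_eq_square right_diff_distrib mult_1_right diff_self)
  then show ?thesis
    by simp
qed

end

theory Submission
  imports Defs "HOL-Computational_Algebra.Polynomial"
begin

text \<open>
  Write \<open>q = 2 ^ k\<close>, let \<open>Tr\<close> be the trace onto the subfield \<open>K\<close> with \<open>q\<close> elements, \<open>\<chi>\<close> the
  canonical additive character, and \<open>\<sigma>\<close> the sign function of a set of \<open>q / 2\<close> elements of \<open>K\<close>.
  The class I function has sign \<open>\<sigma> (Tr s)\<close> at \<open>(x, s x ^ (q + 1))\<close>. Fourier inversion on \<open>K\<close>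
  expands \<open>\<sigma> (Tr s)\<close> as a combination of the characters \<open>\<chi> (c s)\<close> with \<open>c \<in> K\<close>, and balancedness
  of \<open>\<sigma>\<close> makes the coefficient at \<open>c = 0\<close> vanish. Hence in the Walsh sum at \<open>(z s, z ^ (q + 1))\<close>,
  \<open>z \<noteq> 0\<close>, only those \<open>x\<close> survive for which \<open>(x z) ^ (q + 1) \<in> K\<close>, that is \<open>x = r / z\<close> with
  \<open>r \<in> K\<close> (as \<open>x ^ (q + 1)\<close> permutes the field), and then \<open>(x z) ^ (q + 1) = r\<^sup>2\<close>.
  Since \<open>\<chi> (r s) = \<chi> (r\<^sup>2 s\<^sup>2)\<close>, the remaining sum over \<open>r\<close> is again the expansion of \<open>\<sigma>\<close>, now at
  \<open>Tr (s\<^sup>2) = (Tr s)\<^sup>2\<close>. So the dual is the class II function of the set of square roots. As squaring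
  permutes \<open>K\<close>, all class II functions arise in this way, and their duals are
  found from the involutivity of the Walsh transform.
\<close>

text \<open>The fibre is the root set of a polynomial of degree at most \<open>2 ^ (m - k)\<close>.
  This bound drives both the nontriviality of the trace and the lower bound on the size of the
  subfield.\<close>

lemma card_rel_trace_fibre_le:
  fixes c :: "'a::finite_field"
  assumes "k dvd m" "0 < m"
  shows "card {x::'a. rel_trace m k x = c} \<le> 2 ^ (m - k)"
proof -
  obtain n where m: "m = k * n" using assms by blast
  with assms have k: "0 < k" and n: "0 < n" by auto
  then obtain n' where n': "n = Suc n'" by (metis gr0_implies_Suc)
  define p :: "'a poly" where "p = (\<Sum>i<n. monom 1 (2 ^ (k * i))) - [:c:]"
  have div: "m div k = n" using m k by simp
  have poly: "poly p x = rel_trace m k x - c" for x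
    by (simp add: p_def rel_trace_def div poly_sum poly_monom)
  have "degree p \<le> 2 ^ (k * n')"
    unfolding p_def
    by (intro degree_diff_le degree_sum_le order.trans[OF degree_monom_le])
       (use k n' in auto)
  \<comment> \<open>The exponent is positive even for \<open>n' = 0\<close>, so the constant
    \<open>c\<close> does not touch this coefficient.\<close>
  moreover have "coeff p (2 ^ (k * n')) = 1"
  proof -
    have "coeff p (2 ^ (k * n')) =
        (\<Sum>i<n. if i = n' then 1 else 0) - coeff [:c:] (2 ^ (k * n'))"
      unfolding p_def coeff_diff coeff_sum coeff_monom using k
      by (intro arg_cong2[where f = minus] sum.cong) auto
    then show ?thesis by (simp add: n' coeff_pCons split: nat.split)
  qed
  ultimately have "p \<noteq> 0" by auto
  from card_poly_roots_bound[OF this] have "card {x. poly p x = 0} \<le> 2 ^ (k * n')"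
    using \<open>degree p \<le> 2 ^ (k * n')\<close> by linarith
  then show ?thesis by (simp add: poly m n')
qed

section \<open>The binary field, its subfield \<open>K\<close> and the trace onto
  \<open>K\<close>\<close>

locale binary_field_extension =
  fixes m k :: nat and field_type :: "'a::finite_field itself"
  assumes card_field: "CARD('a) = 2 ^ m"
    and k_dvd_m: "k dvd m"
begin

abbreviation K :: "'a set" where "K \<equiv> subfield_pow2 k"
abbreviation Tr :: "'a \<Rightarrow> 'a" where "Tr \<equiv> rel_trace m k"

lemma m_pos: "0 < m"
proof (rule ccontr)
  assume "\<not> 0 < m"
  then have "CARD('a) = 1" using card_field by simp
  moreover have "card {0, 1::'a} \<le> CARD('a)" by (rule card_mono) auto
  ultimately show False by simp
qed

lemma k_pos: "0 < k"
  using k_dvd_m m_pos by (auto intro: gr0I)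

lemma char_2: "CHAR('a) = 2"
proof -
  have "prime CHAR('a)"
    by (rule prime_CHAR_semidom) (simp add: CHAR_pos)
  moreover have "CHAR('a) dvd 2 ^ m"
    using CHAR_dvd_CARD[where ?'a = 'a] card_field by simp
  ultimately show ?thesis
    by (meson prime_dvd_power primes_dvd_imp_eq two_is_prime_nat)
qed

lemma add_self [simp]: "x + x = (0::'a)"
  using uminus_CHAR_2[OF char_2] by (metis add.right_inverse)

lemma add_eq_0_iff_char_2: "x + y = (0::'a) \<longleftrightarrow> x = y"
  using uminus_CHAR_2[OF char_2] by (metis eq_neg_iff_add_eq_0)

lemma frobenius_add: "(x + y :: 'a) ^ (2 ^ n) = x ^ (2 ^ n) + y ^ (2 ^ n)"
  by (rule freshmans_dream'[where n = n]) (simp_all add: char_2)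

lemma frobenius_sum: "sum f A ^ (2 ^ n) = (\<Sum>i\<in>A. (f i :: 'a) ^ (2 ^ n))"
  by (rule freshmans_dream_sum'[where n = n]) (simp_all add: char_2)

lemma power_card [simp]: "(x::'a) ^ (2 ^ m) = x"
  using finite_field_power_card_eq_same[of x] card_field by simp

lemma inj_square: "inj (\<lambda>x::'a. x ^ 2)"
proof (rule injI)
  fix x y :: 'a assume "x ^ 2 = y ^ 2"
  then have "(x + y) ^ 2 = 0" using frobenius_add[of x y 1] by simp
  then show "x = y" by (simp add: add_eq_0_iff_char_2)
qed

lemma zero_in_K: "0 \<in> K" and one_in_K: "1 \<in> K"
  by (auto simp: subfield_pow2_def power_0_left)

lemma K_add: "x \<in> K \<Longrightarrow> y \<in> K \<Longrightarrow> x + y \<in> K"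
  by (simp add: subfield_pow2_def frobenius_add)

lemma K_divide: "x \<in> K \<Longrightarrow> y \<in> K \<Longrightarrow> x / y \<in> K"
  by (simp add: subfield_pow2_def power_divide)

lemma square_in_K_iff: "x ^ 2 \<in> K \<longleftrightarrow> x \<in> K"
  using inj_square by (simp add: subfield_pow2_def inj_def flip: power_mult)
    (metis mult.commute power_mult)

lemma square_image_K: "(\<lambda>x. x ^ 2) ` K = K"
  by (rule endo_inj_surj) (auto simp: square_in_K_iff intro: inj_on_subset[OF inj_square])

lemma K_power_iter: "x \<in> K \<Longrightarrow> x ^ (2 ^ (k * i)) = x"
  by (induction i) (simp_all add: subfield_pow2_def power_add power_mult)

lemma rel_trace_add: "rel_trace m l (x + y :: 'a) = rel_trace m l x + rel_trace m l y"
  by (simp add: rel_trace_def frobenius_add sum.distrib)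

lemma rel_trace_square: "rel_trace m l (x ^ 2 :: 'a) = rel_trace m l x ^ 2"
  unfolding rel_trace_def using frobenius_sum[of "\<lambda>i. x ^ 2 ^ (l * i)" "{..<m div l}" 1]
  by (simp add: power_mult[symmetric] mult.commute)

lemma Tr_scale: "c \<in> K \<Longrightarrow> Tr (c * x) = c * Tr x"
  by (simp add: rel_trace_def power_mult_distrib K_power_iter sum_distrib_left)

lemma Tr_in_K: "Tr x \<in> K"
proof -
  obtain n where m: "m = k * n" using k_dvd_m by blast
  have div: "m div k = n" using m k_pos by simp
  have "Tr x ^ 2 ^ k = (\<Sum>i<n. x ^ 2 ^ (k * Suc i))"
    by (simp add: rel_trace_def div frobenius_sum power_add mult.commute flip: power_mult)
  \<comment> \<open>The Frobenius power shifts the indices by one; the new last term is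
    \<open>x ^ 2 ^ m = x\<close>, which replaces the lost first term.\<close>
  also have "\<dots> = (\<Sum>i<Suc n. x ^ 2 ^ (k * i)) - x"
    by (subst sum.lessThan_Suc_shift) simp
  also have "\<dots> = Tr x" using power_card[of x] by (simp add: rel_trace_def div flip: m)
  finally show ?thesis by (simp add: subfield_pow2_def)
qed

text \<open>Transitivity of the trace: the \<open>m\<close> exponents are cut into
  \<open>m div k\<close> blocks of length \<open>k\<close>, and summing over the blocks first
  produces \<open>Tr x\<close>.\<close>

lemma abs_trace_Tr: "abs_trace m x = (\<Sum>i<k. Tr x ^ (2 ^ i))"
proof -
  obtain n where m: "m = k * n" using k_dvd_m by blast
  have div: "m div k = n" using m k_pos by simp
  have "abs_trace m x = (\<Sum>i<n * k. x ^ 2 ^ i)"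
    by (simp add: abs_trace_def rel_trace_def m mult.commute)
  also have "\<dots> = (\<Sum>j<n. \<Sum>i = j * k..<j * k + k. x ^ 2 ^ i)"
    by (rule sum.nat_group[symmetric])
  also have "\<dots> = (\<Sum>j<n. \<Sum>i<k. x ^ 2 ^ (k * j + i))"
  proof (rule sum.cong[OF refl])
    fix j
    show "(\<Sum>i = j * k..<j * k + k. x ^ 2 ^ i) = (\<Sum>i<k. x ^ 2 ^ (k * j + i))"
      using sum.shift_bounds_nat_ivl[of "\<lambda>i. x ^ 2 ^ i" 0 "j * k" k]
      by (simp add: lessThan_atLeast0 ac_simps)
  qed
  also have "\<dots> = (\<Sum>i<k. Tr x ^ 2 ^ i)"
    by (subst sum.swap) (simp add: rel_trace_def div frobenius_sum power_add power_mult)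
  finally show ?thesis .
qed

text \<open>Otherwise all \<open>2 ^ m\<close> elements would lie in one fibre, which has at most
  \<open>2 ^ (m - 1)\<close>.\<close>

lemma ex_abs_trace_1: "\<exists>w::'a. abs_trace m w = 1"
proof (rule ccontr)
  assume "\<nexists>w::'a. abs_trace m w = 1"
  then have "{x::'a. rel_trace m 1 x = 0} = UNIV"
    using abs_trace_0_or_1[OF card_field] by (auto simp: abs_trace_def)
  then have "2 ^ m \<le> (2::nat) ^ (m - 1)"
    using card_rel_trace_fibre_le[of 1 m "0::'a"] m_pos card_field by simp
  then show False using m_pos by simp
qed

lemma ex_Tr_1: "\<exists>w. Tr w = 1"
proof -
  obtain w :: 'a where w: "abs_trace m w = 1" using ex_abs_trace_1 by blast
  have "Tr w \<noteq> 0"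
    using w by (auto simp: abs_trace_Tr power_0_left)
  then have "Tr (1 / Tr w * w) = 1"
    by (subst Tr_scale) (auto intro: K_divide one_in_K Tr_in_K)
  then show ?thesis by blast
qed

text \<open>Above, \<open>K\<close> consists of the roots of \<open>X ^ (2 ^ k) - X\<close>. Below,
  the fibres of \<open>Tr\<close> over \<open>K\<close> cover the field, and each has at most
  \<open>2 ^ (m - k)\<close> elements.\<close>

lemma card_K: "card K = 2 ^ k"
proof (rule antisym)
  define p :: "'a poly" where "p = monom 1 (2 ^ k) - monom 1 1"
  have k': "2 ^ k > (1::nat)" using k_pos by (intro one_less_power) auto
  have "coeff p (2 ^ k) = 1" using k' by (simp add: p_def)
  then have "p \<noteq> 0" by auto
  then have "card {x. poly p x = 0} \<le> degree p" by (rule card_poly_roots_bound)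
  moreover have "degree p \<le> 2 ^ k"
    unfolding p_def using k'
    by (intro degree_diff_le order.trans[OF degree_monom_le]) auto
  moreover have "{x. poly p x = 0} = K"
    by (auto simp: p_def subfield_pow2_def poly_monom)
  ultimately show "card K \<le> 2 ^ k" by simp
next
  have "UNIV = (\<Union>c\<in>K. {x. Tr x = c})" using Tr_in_K by auto
  then have "CARD('a) \<le> (\<Sum>c\<in>K. card {x. Tr x = c})"
    by (metis card_UN_le finite)
  also have "\<dots> \<le> (\<Sum>c\<in>K. 2 ^ (m - k))"
    by (intro sum_mono card_rel_trace_fibre_le k_dvd_m m_pos)
  finally have "2 ^ m \<le> card K * 2 ^ (m - k)" by (simp add: card_field)
  moreover have "2 ^ m = 2 ^ k * (2::nat) ^ (m - k)"
    using dvd_imp_le[OF k_dvd_m m_pos] by (simp flip: power_add)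
  ultimately show "2 ^ k \<le> card K" by simp
qed

section \<open>The canonical additive character and Fourier inversion on \<open>K\<close>\<close>

definition chi :: "'a \<Rightarrow> int" where
  "chi z = (if abs_trace m z = 1 then - 1 else 1)"

lemma chi_add: "chi (x + y) = chi x * chi y"
proof -
  have "abs_trace m (x + y) = abs_trace m x + abs_trace m y"
    by (simp add: abs_trace_def rel_trace_add)
  then show ?thesis
    using abs_trace_0_or_1[OF card_field, of x] abs_trace_0_or_1[OF card_field, of y]
    by (auto simp: chi_def)
qed

lemma chi_0 [simp]: "chi 0 = 1"
  by (simp add: chi_def abs_trace_def rel_trace_def power_0_left)

lemma chi_square: "chi (x ^ 2) = chi x"
  using abs_trace_0_or_1[OF card_field, of x]
  by (auto simp: chi_def abs_trace_def rel_trace_square)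

text \<open>Translating the summation variable by an element where the character is \<open>-1\<close> negates
  the sum.\<close>

lemma sum_chi_eq_0:
  assumes "c0 \<in> S" and closed: "\<And>x y. x \<in> S \<Longrightarrow> y \<in> S \<Longrightarrow> x + y \<in> S"
    and "chi (c0 * w) = - 1"
  shows "(\<Sum>c\<in>S. chi (c * w)) = 0"
proof -
  have "(\<Sum>c\<in>S. chi (c * w)) = (\<Sum>c\<in>S. chi ((c + c0) * w))"
    using assms(1)
    by (intro sum.reindex_bij_witness[where i = "\<lambda>c. c + c0" and j = "\<lambda>c. c + c0"])
       (auto simp: add.assoc closed)
  also have "\<dots> = - (\<Sum>c\<in>S. chi (c * w))"
    by (simp add: distrib_right chi_add assms(3) sum_negf)
  finally show ?thesis by simp
qed

lemma sum_chi: "(\<Sum>c\<in>UNIV. chi (c * w)) = (if w = 0 then 2 ^ m else 0)"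
proof (cases "w = 0")
  case False
  obtain z :: 'a where "abs_trace m z = 1" using ex_abs_trace_1 by blast
  then have "chi (z / w * w) = - 1" using False by (simp add: chi_def)
  then show ?thesis using sum_chi_eq_0[of "z / w" UNIV w] False by simp
qed (simp add: card_field)

text \<open>For \<open>c\<close> in \<open>K\<close>, \<open>chi (c * w)\<close> depends only on
  \<open>Tr (c * w) = c * Tr w\<close>. If \<open>Tr w\<close> is nonzero, these values exhaust
  \<open>K\<close>, so some \<open>c\<close> gives the value \<open>-1\<close>.\<close>

lemma sum_chi_K: "(\<Sum>c\<in>K. chi (c * w)) = (if Tr w = 0 then 2 ^ k else 0)"
proof (cases "Tr w = 0")
  case True
  have "chi (c * w) = 1" if "c \<in> K" for c
    using that True by (simp add: chi_def abs_trace_Tr Tr_scale power_0_left)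
  then show ?thesis using True by (simp add: card_K)
next
  case False
  obtain z :: 'a where z: "abs_trace m z = 1" using ex_abs_trace_1 by blast
  define c where "c = Tr z / Tr w"
  have c: "c \<in> K" by (simp add: c_def K_divide Tr_in_K)
  then have "Tr (c * w) = Tr z" using False by (subst Tr_scale) (simp_all add: c_def)
  then have "abs_trace m (c * w) = 1" using z by (simp add: abs_trace_Tr)
  then have "chi (c * w) = - 1" by (simp add: chi_def)
  then show ?thesis using sum_chi_eq_0[of c K w] c False K_add by simp
qed

text \<open>With \<open>Tr w = 1\<close>, the element \<open>\<gamma> * w\<close> is a lift of
  \<open>\<gamma>\<close> of trace \<open>\<gamma>\<close>; this lets \<open>chi\<close> on the
  large field supply the characters of \<open>K\<close>. The factor \<open>2 ^ k\<close> keeps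
  everything integral.\<close>

lemma ex_fourier_K:
  fixes \<sigma> :: "'a \<Rightarrow> int"
  assumes "sum \<sigma> K = 0"
  obtains g where "g 0 = 0" "\<And>s. 2 ^ k * \<sigma> (Tr s) = (\<Sum>c\<in>K. g c * chi (c * s))"
proof -
  obtain w where w: "Tr w = 1" using ex_Tr_1 by blast
  define g where "g c = (\<Sum>\<gamma>\<in>K. \<sigma> \<gamma> * chi (c * (\<gamma> * w)))" for c
  have "g 0 = 0" using assms by (simp add: g_def)
  moreover have "2 ^ k * \<sigma> (Tr s) = (\<Sum>c\<in>K. g c * chi (c * s))" for s
  proof -
    have "(\<Sum>c\<in>K. g c * chi (c * s)) = (\<Sum>\<gamma>\<in>K. \<sigma> \<gamma> * (\<Sum>c\<in>K. chi (c * (\<gamma> * w + s))))"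
      unfolding g_def sum_distrib_right sum_distrib_left
      by (subst sum.swap) (simp add: distrib_left chi_add mult.assoc)
    also have "\<dots> = (\<Sum>\<gamma>\<in>K. if \<gamma> = Tr s then 2 ^ k * \<sigma> \<gamma> else 0)"
      by (intro sum.cong refl)
         (simp add: sum_chi_K rel_trace_add Tr_scale w add_eq_0_iff_char_2)
    also have "\<dots> = 2 ^ k * \<sigma> (Tr s)" using Tr_in_K by simp
    finally show ?thesis by simp
  qed
  ultimately show ?thesis using that by blast
qed

section \<open>The Walsh transform as a character sum and its involutivity\<close>

lemma walsh_eq_sum_chi:
  "walsh m h (u, v) = (\<Sum>x\<in>UNIV. \<Sum>y\<in>UNIV. (-1) ^ of_bool (h (x, y)) * chi (u * x + v * y))"
  unfolding walsh_def by (auto simp: chi_def intro!: sum.cong)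

lemma walsh_involution:
  fixes g h :: "'a \<times> 'a \<Rightarrow> bool"
  assumes "\<And>u v. walsh m h (u, v) = 2 ^ m * (-1) ^ of_bool (g (u, v))"
  shows "walsh m g (a, b) = 2 ^ m * (-1) ^ of_bool (h (a, b))"
proof -
  define H where "H x y = ((-1) ^ of_bool (h (x, y)) :: int)" for x y
  have "2 ^ m * walsh m g (a, b) = (\<Sum>u\<in>UNIV. \<Sum>v\<in>UNIV. walsh m h (u, v) * chi (a * u + b * v))"
    by (simp add: walsh_eq_sum_chi[of g] assms sum_distrib_left mult.assoc)
  also have "\<dots> = (\<Sum>u\<in>UNIV. \<Sum>v\<in>UNIV. \<Sum>x\<in>UNIV. \<Sum>y\<in>UNIV.
      H x y * (chi (u * (x + a)) * chi (v * (y + b))))"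
    unfolding walsh_eq_sum_chi H_def sum_distrib_right
    by (intro sum.cong refl) (simp add: chi_add algebra_simps)
  also have "\<dots> = (\<Sum>u\<in>UNIV. \<Sum>x\<in>UNIV. \<Sum>v\<in>UNIV. \<Sum>y\<in>UNIV.
      H x y * (chi (u * (x + a)) * chi (v * (y + b))))"
    \<comment> \<open>The swaps move the sums over \<open>u\<close> and \<open>v\<close> innermost,
      where they factor and orthogonality leaves only \<open>x = a\<close>,
      \<open>y = b\<close>.\<close>
    by (intro sum.cong refl sum.swap)
  also have "\<dots> = (\<Sum>x\<in>UNIV. \<Sum>u\<in>UNIV. \<Sum>y\<in>UNIV. \<Sum>v\<in>UNIV.
      H x y * (chi (u * (x + a)) * chi (v * (y + b))))"
    by (subst sum.swap) (intro sum.cong refl sum.swap)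
  also have "\<dots> = (\<Sum>x\<in>UNIV. \<Sum>y\<in>UNIV. \<Sum>u\<in>UNIV. \<Sum>v\<in>UNIV.
      H x y * (chi (u * (x + a)) * chi (v * (y + b))))"
    by (intro sum.cong refl sum.swap)
  also have "\<dots> = (\<Sum>x\<in>UNIV. \<Sum>y\<in>UNIV.
      H x y * ((\<Sum>u\<in>UNIV. chi (u * (x + a))) * (\<Sum>v\<in>UNIV. chi (v * (y + b)))))"
    unfolding sum_product unfolding sum_distrib_left by (rule refl)
  also have "\<dots> = (\<Sum>x\<in>UNIV. \<Sum>y\<in>UNIV. if y = b then if x = a then 2 ^ m * (2 ^ m * H x y) else 0 else 0)"
    by (intro sum.cong refl) (simp add: sum_chi add_eq_0_iff_char_2)
  also have "\<dots> = 2 ^ m * (2 ^ m * H a b)" by simp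
  finally show ?thesis by (simp add: H_def)
qed

section \<open>Balanced signs and pointwise descriptions of the two classes\<close>

lemma sum_sign_eq_0:
  assumes "\<Gamma> \<subseteq> K" "card \<Gamma> = 2 ^ (k - 1)"
  shows "(\<Sum>\<gamma>\<in>K. (-1) ^ of_bool (\<gamma> \<in> \<Gamma>) :: int) = 0"
proof -
  have "(\<Sum>\<gamma>\<in>K. (-1) ^ of_bool (\<gamma> \<in> \<Gamma>) :: int) = (\<Sum>\<gamma>\<in>K. 1 - 2 * of_bool (\<gamma> \<in> \<Gamma>))"
    by (intro sum.cong) auto
  also have "\<dots> = int (card K) - 2 * int (card \<Gamma>)"
    using assms(1) by (simp add: sum_subtractf Int_absorb1 flip: sum_distrib_left)
  also have "\<dots> = 0"
    using k_pos by (simp add: card_K assms(2) power_eq_if)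
  finally show ?thesis .
qed

lemma mem_set_A: "(x, y) \<in> set_A m k \<gamma> \<longleftrightarrow> x \<noteq> 0 \<and> Tr (y / x ^ (2 ^ k + 1)) = \<gamma>"
proof
  assume "x \<noteq> 0 \<and> Tr (y / x ^ (2 ^ k + 1)) = \<gamma>"
  then show "(x, y) \<in> set_A m k \<gamma>"
    unfolding set_A_def by (intro UN_I[of "y / x ^ (2 ^ k + 1)"]) auto
qed (auto simp: set_A_def)

lemma mem_set_B: "(x, y) \<in> set_B m k d \<gamma> \<longleftrightarrow> y \<noteq> 0 \<and> Tr (x / y powi - d) = \<gamma>"
proof
  assume "y \<noteq> 0 \<and> Tr (x / y powi - d) = \<gamma>"
  then show "(x, y) \<in> set_B m k d \<gamma>"
    unfolding set_B_def by (intro UN_I[of "x / y powi - d"]) (auto simp: power_int_minus)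
qed (auto simp: set_B_def power_int_minus)

text \<open>The truth value \<open>\<epsilon>\<close> records whether \<open>set_U\<close> belongs
  to the support, so that both variants are handled at once.\<close>

lemma class_I_iff:
  "h \<in> class_I m k \<longleftrightarrow> (\<exists>\<Gamma> \<subseteq> K. card \<Gamma> = 2 ^ (k - 1) \<and>
     (\<exists>\<epsilon>. \<forall>x y. h (x, y) \<longleftrightarrow> (if x = 0 then \<epsilon> else Tr (y / x ^ (2 ^ k + 1)) \<in> \<Gamma>)))"
proof -
  have support: "bool_support h = (\<Union>\<gamma>\<in>\<Gamma>. set_A m k \<gamma>) \<longleftrightarrow>
      (\<forall>x y. h (x, y) \<longleftrightarrow> (if x = 0 then False else Tr (y / x ^ (2 ^ k + 1)) \<in> \<Gamma>))"
    "bool_support h = set_U \<union> (\<Union>\<gamma>\<in>\<Gamma>. set_A m k \<gamma>) \<longleftrightarrow>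
      (\<forall>x y. h (x, y) \<longleftrightarrow> (if x = 0 then True else Tr (y / x ^ (2 ^ k + 1)) \<in> \<Gamma>))" for \<Gamma>
    by (auto simp: bool_support_def set_eq_iff mem_set_A set_U_def)
  show ?thesis unfolding class_I_def mem_Collect_eq support ex_bool_eq by (simp only: disj_commute)
qed

lemma class_II_iff:
  "h \<in> class_II m k d \<longleftrightarrow> (\<exists>\<Gamma> \<subseteq> K. card \<Gamma> = 2 ^ (k - 1) \<and>
     (\<exists>\<epsilon>. \<forall>x y. h (x, y) \<longleftrightarrow> (if y = 0 then \<epsilon> else Tr (x / y powi - d) \<in> \<Gamma>)))"
proof -
  have support: "bool_support h = (\<Union>\<gamma>\<in>\<Gamma>. set_B m k d \<gamma>) \<longleftrightarrow>
      (\<forall>x y. h (x, y) \<longleftrightarrow> (if y = 0 then False else Tr (x / y powi - d) \<in> \<Gamma>))"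
    "bool_support h = set_V \<union> (\<Union>\<gamma>\<in>\<Gamma>. set_B m k d \<gamma>) \<longleftrightarrow>
      (\<forall>x y. h (x, y) \<longleftrightarrow> (if y = 0 then True else Tr (x / y powi - d) \<in> \<Gamma>))" for \<Gamma>
    by (auto simp: bool_support_def set_eq_iff mem_set_B set_V_def)
  show ?thesis unfolding class_II_def mem_Collect_eq support ex_bool_eq by (simp only: disj_commute)
qed

end

section \<open>The Walsh transform of class I and the duality of the classes\<close>

locale binary_field_extension_root = binary_field_extension +
  fixes d :: int
  assumes d_inverse: "[d * (2 ^ m - 2 ^ k - 2) = 1] (mod 2 ^ m - 1)"
begin

text \<open>Since \<open>2 ^ m - 2 ^ k - 2\<close> is congruent to \<open>-(2 ^ k + 1)\<close>
  modulo \<open>2 ^ m - 1\<close>, so is \<open>- d * (2 ^ k + 1)\<close> to \<open>1\<close>. Hence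
  \<open>- d\<close> is the exponent that inverts the power map \<open>2 ^ k + 1\<close> on nonzero
  elements.\<close>

lemma powi_root:
  assumes "(x::'a) \<noteq> 0"
  shows "x powi (- d * (2 ^ k + 1)) = x"
proof -
  obtain j where j: "d * (2 ^ m - 2 ^ k - 2) - 1 = (2 ^ m - 1) * j"
    using d_inverse by (auto simp: cong_iff_dvd_diff)
  have "- d * (2 ^ k + 1) = 1 + (2 ^ m - 1) * (j - d)"
    using j by (simp add: algebra_simps)
  moreover have "x powi (2 ^ m - 1) = 1"
  proof -
    have "x powi (2 ^ m - 1) = x powi int (2 ^ m) / x"
      using assms by (simp add: power_int_diff del: power_int_of_nat)
    then show ?thesis using assms by (simp del: of_nat_power)
  qed
  ultimately show ?thesis using assms by (simp add: power_int_add power_int_mult)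
qed

lemma root_power: "v \<noteq> 0 \<Longrightarrow> ((v::'a) powi - d) ^ (2 ^ k + 1) = v"
  using powi_root[of v] by (simp add: power_int_power' add.commute del: power_Suc)

lemma power_root: "v \<noteq> 0 \<Longrightarrow> ((v::'a) ^ (2 ^ k + 1)) powi - d = v"
  using powi_root[of v] by (simp add: power_int_power ac_simps del: power_Suc)

lemma K_power: "r \<in> K \<Longrightarrow> r ^ (2 ^ k + 1) = r ^ 2"
  by (simp add: subfield_pow2_def power2_eq_square)

text \<open>On \<open>K\<close> the power map is squaring, which is onto \<open>K\<close>; so
  \<open>t\<close> shares its power with some \<open>r\<close> in \<open>K\<close>, and injectivity
  gives \<open>t = r\<close>.\<close>

lemma in_K_if_power_in_K:
  assumes "t ^ (2 ^ k + 1) \<in> K"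
  shows "t \<in> K"
proof (cases "t = 0")
  case False
  obtain r where r: "r \<in> K" "t ^ (2 ^ k + 1) = r ^ 2"
    using assms square_image_K by blast
  then have "t ^ (2 ^ k + 1) = r ^ (2 ^ k + 1)" by (simp only: K_power)
  moreover have "r \<noteq> 0" using r False by auto
  ultimately have "t = r" using False power_root by metis
  then show ?thesis using r by simp
qed (simp add: zero_in_K)

lemma walsh_class_I:
  assumes \<Gamma>: "\<Gamma> \<subseteq> K" "card \<Gamma> = 2 ^ (k - 1)"
    and h: "\<And>x y. h (x, y) \<longleftrightarrow> (if x = 0 then \<epsilon> else Tr (y / x ^ (2 ^ k + 1)) \<in> \<Gamma>)"
  shows "walsh m h (u, v) =
    2 ^ m * (-1) ^ of_bool (if v = 0 then \<epsilon> else Tr (u / v powi - d) ^ 2 \<in> \<Gamma>)"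
proof -
  define \<sigma> :: "'a \<Rightarrow> int" where "\<sigma> \<gamma> = (-1) ^ of_bool (\<gamma> \<in> \<Gamma>)" for \<gamma>
  have "sum \<sigma> K = 0" unfolding \<sigma>_def by (rule sum_sign_eq_0[OF \<Gamma>])
  then obtain g where g0: "g 0 = 0"
    and g: "\<And>s. 2 ^ k * \<sigma> (Tr s) = (\<Sum>c\<in>K. g c * chi (c * s))"
    using ex_fourier_K by blast
  define I where "I x = (\<Sum>y\<in>UNIV. (-1) ^ of_bool (h (x, y)) * chi (u * x + v * y))" for x
  define P where "P x = v * x ^ (2 ^ k + 1)" for x
  have walsh: "walsh m h (u, v) = I 0 + (\<Sum>x\<in>UNIV - {0}. I x)"
    unfolding walsh_eq_sum_chi I_def by (rule sum.remove) auto
  \<comment> \<open>On the line \<open>x = 0\<close> the sign is constant, so only the full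
    character sum over \<open>y\<close> remains.\<close>
  have I0: "I 0 = (if v = 0 then 2 ^ m * (-1) ^ of_bool \<epsilon> else 0)"
    using sum_chi[of v] by (simp add: I_def h mult.commute flip: sum_distrib_left)
  have I: "2 ^ k * I x = (if P x \<in> K then 2 ^ m * (chi (u * x) * g (P x)) else 0)"
    if x: "x \<noteq> 0" for x
  proof -
    \<comment> \<open>Substitution \<open>y = s * x ^ (2 ^ k + 1)\<close>; the Fourier expansion
      then makes the sum over \<open>s\<close> select the coefficient at \<open>P x\<close>.\<close>
    have "I x = (\<Sum>s\<in>UNIV. \<sigma> (Tr s) * chi (u * x + P x * s))"
      unfolding I_def
      by (rule sum.reindex_bij_witness[where i = "\<lambda>s. s * x ^ (2 ^ k + 1)"
            and j = "\<lambda>y. y / x ^ (2 ^ k + 1)"])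
         (use x in \<open>auto simp: h \<sigma>_def P_def\<close>)
    then have "2 ^ k * I x = chi (u * x) * (\<Sum>s\<in>UNIV. (2 ^ k * \<sigma> (Tr s)) * chi (P x * s))"
      by (simp add: sum_distrib_left chi_add ac_simps)
    also have "(\<Sum>s\<in>UNIV. (2 ^ k * \<sigma> (Tr s)) * chi (P x * s)) =
        (\<Sum>c\<in>K. g c * (\<Sum>s\<in>UNIV. chi (s * (c + P x))))"
      unfolding g sum_distrib_right sum_distrib_left
      by (subst sum.swap) (simp add: chi_add algebra_simps)
    also have "\<dots> = (\<Sum>c\<in>K. if c = P x then 2 ^ m * g c else 0)"
      by (intro sum.cong refl) (simp add: sum_chi add_eq_0_iff_char_2)
    also have "\<dots> = (if P x \<in> K then 2 ^ m * g (P x) else 0)" by simp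
    finally show ?thesis by simp
  qed
  show ?thesis
  proof (cases "v = 0")
    case True
    \<comment> \<open>Here \<open>P x = 0\<close>, and the coefficient \<open>g 0\<close> vanishes
      by balancedness.\<close>
    then have "I x = 0" if "x \<noteq> 0" for x
      using I[OF that] g0 by (simp add: P_def zero_in_K)
    then have "(\<Sum>x\<in>UNIV - {0}. I x) = 0" by simp
    then show ?thesis unfolding walsh I0 using True by simp
  next
    case False
    define z where "z = v powi - d"
    have z: "z ^ (2 ^ k + 1) = v" unfolding z_def by (rule root_power[OF False])
    then have z0: "z \<noteq> 0" using False by auto
    have P: "P x = (x * z) ^ (2 ^ k + 1)" for x
      by (simp only: P_def power_mult_distrib z mult.commute)
    have "2 ^ k * walsh m h (u, v) =
        (\<Sum>x\<in>UNIV - {0}. if P x \<in> K then 2 ^ m * (chi (u * x) * g (P x)) else 0)"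
      unfolding walsh by (simp add: I0 False sum_distrib_left I)
    \<comment> \<open>The term at \<open>x = 0\<close> can be added back because
      \<open>P 0 = 0\<close> and \<open>g 0 = 0\<close>.\<close>
    also have "\<dots> = (\<Sum>x\<in>UNIV. if P x \<in> K then 2 ^ m * (chi (u * x) * g (P x)) else 0)"
      by (rule sum.mono_neutral_left) (auto simp: P_def g0)
    also have "\<dots> = (\<Sum>x\<in>{x. P x \<in> K}. 2 ^ m * (chi (u * x) * g (P x)))"
      using sum.inter_filter[of UNIV "\<lambda>x. 2 ^ m * (chi (u * x) * g (P x))" "\<lambda>x. P x \<in> K"] by simp
    also have "\<dots> = (\<Sum>r\<in>K. 2 ^ m * (g (r ^ 2) * chi (r ^ 2 * (u / z) ^ 2)))"
    proof (rule sum.reindex_bij_witness[where i = "\<lambda>r. r / z" and j = "\<lambda>x. x * z"])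
      fix x assume "x \<in> {x. P x \<in> K}"
      then show K: "x * z \<in> K" unfolding P by (auto intro: in_K_if_power_in_K)
      have "chi ((x * z) ^ 2 * (u / z) ^ 2) = chi (x * z * (u / z))"
        by (simp only: power_mult_distrib[symmetric] chi_square)
      then show "2 ^ m * (g ((x * z) ^ 2) * chi ((x * z) ^ 2 * (u / z) ^ 2)) =
          2 ^ m * (chi (u * x) * g (P x))"
        unfolding P K_power[OF K] using z0 by (simp add: mult.commute)
    next
      fix r assume r: "r \<in> K"
      have "r / z * z = r" using z0 by simp
      then have "P (r / z) = r ^ 2" unfolding P by (simp only: K_power[OF r])
      then show "r / z \<in> {x. P x \<in> K}"
        using r by (simp add: square_in_K_iff)
    qed (use z0 in auto)
    \<comment> \<open>With \<open>c = r ^ 2\<close> running through \<open>K\<close>, this is the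
      Fourier expansion of \<open>\<sigma>\<close> again.\<close>
    also have "\<dots> = 2 ^ m * (\<Sum>c\<in>(\<lambda>r. r ^ 2) ` K. g c * chi (c * (u / z) ^ 2))"
      by (subst sum.reindex) (auto simp: sum_distrib_left intro: inj_on_subset[OF inj_square])
    also have "\<dots> = 2 ^ k * (2 ^ m * \<sigma> (Tr (u / z) ^ 2))"
      unfolding square_image_K g[symmetric] rel_trace_square by simp
    finally show ?thesis using False by (simp add: \<sigma>_def z_def)
  qed
qed

lemma class_I_dual_in_class_II:
  fixes h :: "'a \<times> 'a \<Rightarrow> bool"
  assumes "h \<in> class_I m k"
  shows "\<exists>g \<in> class_II m k d. \<forall>u v. walsh m h (u, v) = 2 ^ m * (-1) ^ of_bool (g (u, v))"
proof -
  obtain \<Gamma> \<epsilon> where \<Gamma>: "\<Gamma> \<subseteq> K" "card \<Gamma> = 2 ^ (k - 1)"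
    and h: "\<And>x y. h (x, y) \<longleftrightarrow> (if x = 0 then \<epsilon> else Tr (y / x ^ (2 ^ k + 1)) \<in> \<Gamma>)"
    using assms unfolding class_I_iff by blast
  define g where "g = (\<lambda>(u, v). if v = 0 then \<epsilon> else Tr (u / v powi - d) ^ 2 \<in> \<Gamma>)"
  define \<Delta> where "\<Delta> = {\<gamma> \<in> K. \<gamma> ^ 2 \<in> \<Gamma>}"
  have "(\<lambda>x. x ^ 2) ` \<Delta> = \<Gamma>"
    using \<Gamma>(1) square_image_K by (auto simp: \<Delta>_def)
  then have "card \<Delta> = 2 ^ (k - 1)"
    using \<Gamma>(2) card_image[OF inj_on_subset[OF inj_square subset_UNIV], of \<Delta>] by simp
  moreover have "g (u, v) \<longleftrightarrow> (if v = 0 then \<epsilon> else Tr (u / v powi - d) \<in> \<Delta>)" for u v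
    by (simp add: g_def \<Delta>_def Tr_in_K)
  moreover have "\<Delta> \<subseteq> K" by (auto simp: \<Delta>_def)
  ultimately have "g \<in> class_II m k d"
    unfolding class_II_iff by blast
  then show ?thesis
    using walsh_class_I[OF \<Gamma> h] by (intro bexI[of _ g]) (auto simp: g_def)
qed

text \<open>Choosing \<open>\<Gamma>\<close> as the set of squares of \<open>\<Delta>\<close> undoes
  the squaring in \<open>walsh_class_I\<close>. In this form class II needs no Walsh sum of its
  own.\<close>

lemma class_II_eq_dual_of_class_I:
  fixes g :: "'a \<times> 'a \<Rightarrow> bool"
  assumes "g \<in> class_II m k d"
  shows "\<exists>h \<in> class_I m k. \<forall>u v. walsh m h (u, v) = 2 ^ m * (-1) ^ of_bool (g (u, v))"
proof -
  obtain \<Delta> \<epsilon> where \<Delta>: "\<Delta> \<subseteq> K" "card \<Delta> = 2 ^ (k - 1)"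
    and g: "\<And>x y. g (x, y) \<longleftrightarrow> (if y = 0 then \<epsilon> else Tr (x / y powi - d) \<in> \<Delta>)"
    using assms unfolding class_II_iff by blast
  define \<Gamma> where "\<Gamma> = (\<lambda>x. x ^ 2) ` \<Delta>"
  have \<Gamma>: "\<Gamma> \<subseteq> K" "card \<Gamma> = 2 ^ (k - 1)"
    using \<Delta> square_in_K_iff card_image[OF inj_on_subset[OF inj_square subset_UNIV], of \<Delta>]
    by (auto simp: \<Gamma>_def)
  define h where "h = (\<lambda>(x, y). if x = 0 then \<epsilon> else Tr (y / x ^ (2 ^ k + 1)) \<in> \<Gamma>)"
  have h: "h (x, y) \<longleftrightarrow> (if x = 0 then \<epsilon> else Tr (y / x ^ (2 ^ k + 1)) \<in> \<Gamma>)" for x y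
    by (simp add: h_def)
  then have "h \<in> class_I m k" unfolding class_I_iff using \<Gamma> by blast
  moreover have "x ^ 2 \<in> \<Gamma> \<longleftrightarrow> x \<in> \<Delta>" for x
    unfolding \<Gamma>_def by (rule inj_image_mem_iff[OF inj_square])
  ultimately show ?thesis
    using walsh_class_I[OF \<Gamma> h] by (intro bexI[of _ h]) (simp_all add: g)
qed

end

lemma bentI:
  assumes "\<And>u v. walsh m h (u, v) = 2 ^ m * (-1) ^ of_bool (g (u, v))"
  shows "bent m h"
  by (simp add: bent_def assms abs_mult power_abs)

theorem theorem13:
  fixes m k :: nat and e d :: int
  assumes "CARD('a::finite_field) = 2 ^ m"
    and "k dvd m"
    and "gcd (2 ^ m - 1 :: int) (2 ^ k + 1) = 1"
    and "e = 2 ^ m - 2 ^ k - 2"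
    and "[d * e = 1] (mod (2 ^ m - 1))"
  shows "(\<forall>h \<in> (class_I m k :: ('a \<times> 'a \<Rightarrow> bool) set). bent m h)
    \<and> (\<forall>h \<in> (class_II m k d :: ('a \<times> 'a \<Rightarrow> bool) set). bent m h)
    \<and> (\<forall>h \<in> (class_I m k :: ('a \<times> 'a \<Rightarrow> bool) set). bent_dual m h \<in> class_II m k d)
    \<and> (\<forall>h \<in> (class_II m k d :: ('a \<times> 'a \<Rightarrow> bool) set). bent_dual m h \<in> class_I m k)"
proof -
  interpret binary_field_extension_root m k "TYPE('a)" d
    using assms by unfold_locales simp_all
  have I: "bent m h \<and> bent_dual m h \<in> class_II m k d"
    if h_in: "h \<in> class_I m k" for h :: "'a \<times> 'a \<Rightarrow> bool"
  proof -
    obtain g where "g \<in> class_II m k d"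
      and g: "\<And>u v. walsh m h (u, v) = 2 ^ m * (-1) ^ of_bool (g (u, v))"
      using class_I_dual_in_class_II[OF h_in] by blast
    then show ?thesis using bentI[OF g] bent_dual_unique[OF g] by simp
  qed
  have II: "bent m g \<and> bent_dual m g \<in> class_I m k"
    if g_in: "g \<in> class_II m k d" for g :: "'a \<times> 'a \<Rightarrow> bool"
  proof -
    obtain h where "h \<in> class_I m k"
      and h: "\<And>u v. walsh m h (u, v) = 2 ^ m * (-1) ^ of_bool (g (u, v))"
      using class_II_eq_dual_of_class_I[OF g_in] by blast
    \<comment> \<open>Involutivity exchanges the roles: as \<open>g\<close> is the dual of
      \<open>h\<close>, the dual of \<open>g\<close> is \<open>h\<close>.\<close>
    note g = walsh_involution[OF h]
    show ?thesis using bentI[OF g] bent_dual_unique[OF g] \<open>h \<in> class_I m k\<close> by simp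
  qed
  show ?thesis using I II by blast
qed

end
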